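(* There exists an absolute constant $c_0>0$ such that for every integer $n\ge 1$ there exists an analytic polynomial $P_n$ of degree $n$ of two complex variables such that \[ \left\|\left(z_1\frac{\partial}{\partial z_1}\right)^2P_n\right\|_{A(D^2)}\leq 1\quad\text{and}\quad \left\|\left(z_2\frac{\partial}{\partial z_2}\right)^2P_n\right\|_{A(D^2)}\leq 1 \] but \[ \left\|z_2\frac{\partial}{\partial z_2}\left(z_1\frac{\partial}{\partial z_1}\right)P_n\right\|_{A(D^2)}\geq c_0\,(\log n)^{1/8}. \]
   Context: $D^2=\{(z_1,z_2)\in\mathbb{C}^2: |z_1|<1,\ |z_2|<1\}$ is the unit bi-disc. An analytic polynomial is a polynomial in the two complex variables $z_1,z_2$ with complex coefficients; degree means total degree. $\|G\|_{A(D^2)}=\sup_{z\in D^2}|G(z)|$ is the supremum norm. $\left(z_j\frac{\partial}{\partial z_j}\right)^2$ denotes the operator $z_j\frac{\partial}{\partial z_j}$ applied twice. *)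

theory Defs
  imports "HOL-Analysis.Analysis" "HOL-Computational_Algebra.Polynomial"
begin

definition bidisc :: "(complex \<times> complex) set" where
  "bidisc = {(z1, z2). norm z1 < 1 \<and> norm z2 < 1}"

text \<open>
  An analytic polynomial in \<open>z1\<close>, \<open>z2\<close> is an element of \<open>\<complex>[z1][z2]\<close>:
  the outer variable is \<open>z2\<close>, so \<open>coeff (coeff P j) i\<close> is the coefficient of the
  monomial \<open>z1 ^ i * z2 ^ j\<close>.
\<close>

definition poly2 :: "complex poly poly \<Rightarrow> complex \<times> complex \<Rightarrow> complex" where
  "poly2 P = (\<lambda>(z1, z2). poly (poly P [:z2:]) z1)"

definition total_degree :: "complex poly poly \<Rightarrow> nat" where
  "total_degree P = (if P = 0 then 0 else Max {i + j | i j. coeff (coeff P j) i \<noteq> 0})"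

text \<open>
  The operators \<open>z1 * \<partial>/\<partial>z1\<close> and \<open>z2 * \<partial>/\<partial>z2\<close> on functions of two complex variables.
\<close>

definition euler1 :: "(complex \<times> complex \<Rightarrow> complex) \<Rightarrow> complex \<times> complex \<Rightarrow> complex" where
  "euler1 f = (\<lambda>(z1, z2). z1 * deriv (\<lambda>w. f (w, z2)) z1)"

definition euler2 :: "(complex \<times> complex \<Rightarrow> complex) \<Rightarrow> complex \<times> complex \<Rightarrow> complex" where
  "euler2 f = (\<lambda>(z1, z2). z2 * deriv (\<lambda>w. f (z1, w)) z2)"

text \<open>
  The supremum is taken in the reals, so it is meaningful only for functions bounded on
  the bidisc; this covers all polynomial functions.
\<close>

definition bidisc_norm :: "(complex \<times> complex \<Rightarrow> complex) \<Rightarrow> real" where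
  "bidisc_norm G = (SUP z\<in>bidisc. norm (G z))"

end

theory Submission
  imports Defs
begin

text \<open>
  Let \<open>N = 2 ^ k\<close> and \<open>h\<^sub>k(z) = N\<^sup>-\<^sup>2 (1 - z ^ N) (1 + z + \<dots> + z ^ (N - 1))\<close>. On the disc
  \<open>\<bar>h\<^sub>k(z)\<bar> \<le> N\<^sup>-\<^sup>1 min (x, 4 / x)\<close> with \<open>x = N \<bar>1 - z\<bar>\<close>, while the second Euler
  derivative of \<open>h\<^sub>k\<close> is \<open>O(N)\<close>. Hence in \<open>\<Sum>k<K. h\<^sub>k(z\<^sub>1) h\<^sub>k(z\<^sub>2)\<close> both pure second derivatives are
  bounded uniformly in \<open>K\<close>, because the numbers \<open>min (2 ^ k d, 4 / (2 ^ k d))\<close> have a sum bounded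
  independently of \<open>d > 0\<close>. The first Euler derivative of \<open>h\<^sub>k\<close> at \<open>1\<close> is \<open>-1\<close>, so the mixed
  derivative at \<open>(1, 1)\<close> equals \<open>K\<close>, which is of order \<open>log n\<close> for degree \<open>n\<close>. A multiple
  of \<open>z\<^sub>1 ^ n\<close> is added to make the degree exactly \<open>n\<close>.
\<close>

section \<open>Euler derivatives of sums of products\<close>

definition theta :: "complex poly \<Rightarrow> complex poly" where
  "theta p = pCons 0 (pderiv p)"

text \<open>Represents p(z1) q(z2): as z2 is the outer variable, the coefficients of
  \<open>q\<close> become constant polynomials in z1.\<close>

definition tensor :: "complex poly \<Rightarrow> complex poly \<Rightarrow> complex poly poly" where
  "tensor p q = smult p (map_poly (\<lambda>c. [:c:]) q)"

text \<open>This class of functions is stable under both Euler operators, each acting on one factor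
  only, so iterated derivatives reduce to applying \<open>theta\<close> to univariate
  polynomials.\<close>

definition sum_prod :: "('i \<Rightarrow> complex poly) \<Rightarrow> ('i \<Rightarrow> complex poly) \<Rightarrow> 'i set \<Rightarrow> complex \<times> complex \<Rightarrow> complex"
  where "sum_prod p q A = (\<lambda>(x, y). \<Sum>k\<in>A. poly (p k) x * poly (q k) y)"

lemma poly_theta: "poly (theta p) x = x * poly (pderiv p) x"
  by (simp add: theta_def)

lemma coeff_theta: "coeff (theta p) j = of_nat j * coeff p j"
  by (cases j) (auto simp: theta_def coeff_pderiv)

lemma theta_sum_monom: "theta (\<Sum>j\<in>A. monom (c j) j) = (\<Sum>j\<in>A. monom (of_nat j * c j) j)"
proof (rule poly_eqI)
  fix i
  show "coeff (theta (\<Sum>j\<in>A. monom (c j) j)) i = coeff (\<Sum>j\<in>A. monom (of_nat j * c j) j) i"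
    unfolding coeff_theta coeff_sum sum_distrib_left by (rule sum.cong) auto
qed

lemma coeff_tensor: "coeff (coeff (tensor p q) j) i = coeff p i * coeff q j"
  by (simp add: tensor_def coeff_map_poly mult.commute)

lemma poly_map_poly_const: "poly (map_poly (\<lambda>c. [:c:]) q) [:y:] = [:poly q (y::complex):]"
  by (induction q) (auto simp: map_poly_pCons)

lemma poly2_sum_tensor: "poly2 (\<Sum>k\<in>A. tensor (p k) (q k)) = sum_prod p q A"
  by (auto simp: fun_eq_iff poly2_def sum_prod_def tensor_def poly_sum poly_map_poly_const mult.commute)

lemma euler1_sum_prod: "euler1 (sum_prod p q A) = sum_prod (\<lambda>k. theta (p k)) q A"
proof (intro ext, clarify)
  fix x y
  have "((\<lambda>w. \<Sum>k\<in>A. poly (p k) w * poly (q k) y) has_field_derivative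
          (\<Sum>k\<in>A. poly (pderiv (p k)) x * poly (q k) y)) (at x)"
    by (auto intro!: derivative_eq_intros)
  then show "euler1 (sum_prod p q A) (x, y) = sum_prod (\<lambda>k. theta (p k)) q A (x, y)"
    by (simp add: euler1_def sum_prod_def DERIV_imp_deriv poly_theta sum_distrib_left mult.assoc)
qed

lemma euler2_sum_prod: "euler2 (sum_prod p q A) = sum_prod p (\<lambda>k. theta (q k)) A"
proof (intro ext, clarify)
  fix x y
  have "((\<lambda>w. \<Sum>k\<in>A. poly (p k) x * poly (q k) w) has_field_derivative
          (\<Sum>k\<in>A. poly (p k) x * poly (pderiv (q k)) y)) (at y)"
    by (auto intro!: derivative_eq_intros simp: mult.commute)
  then show "euler2 (sum_prod p q A) (x, y) = sum_prod p (\<lambda>k. theta (q k)) A (x, y)"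
    by (simp add: euler2_def sum_prod_def DERIV_imp_deriv poly_theta sum_distrib_left mult.left_commute)
qed

lemma continuous_on_sum_prod: "continuous_on S (sum_prod p q A)"
  unfolding sum_prod_def case_prod_beta by (intro continuous_intros)

section \<open>The supremum norm on the bidisc\<close>

lemma bidisc_eq: "bidisc = ball 0 1 \<times> ball 0 1"
  by (auto simp: bidisc_def)

lemma bidisc_norm_le:
  assumes "\<And>x y. norm x < 1 \<Longrightarrow> norm y < 1 \<Longrightarrow> norm (G (x, y)) \<le> B"
  shows "bidisc_norm G \<le> B"
  unfolding bidisc_norm_def bidisc_def
  by (rule cSUP_least) (use assms in \<open>auto intro!: exI[of _ 0]\<close>)

text \<open>By continuity the bound on the open bidisc passes to its closure. This permits
  evaluation at (1, 1), which is not in \<open>bidisc\<close>.\<close>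

lemma norm_le_bidisc_norm:
  assumes G: "continuous_on UNIV G" and "norm x \<le> 1" "norm y \<le> 1"
  shows "norm (G (x, y)) \<le> bidisc_norm G"
proof -
  \<comment> \<open>Compactness of the closed bidisc gives the boundedness without which the real
    supremum says nothing.\<close>
  have "compact ((\<lambda>z. norm (G z)) ` (cball 0 1 \<times> cball 0 1))"
    by (intro compact_continuous_image compact_Times compact_cball continuous_on_norm
          continuous_on_subset[OF G]) auto
  then have "bdd_above ((\<lambda>z. norm (G z)) ` (cball 0 1 \<times> cball 0 1))"
    by (intro bounded_imp_bdd_above compact_imp_bounded)
  then have bdd: "bdd_above ((\<lambda>z. norm (G z)) ` bidisc)"
    by (rule bdd_above_mono) (auto simp: bidisc_eq)
  have "bidisc \<subseteq> {z. norm (G z) \<le> bidisc_norm G}"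
    unfolding bidisc_norm_def using bdd by (auto intro: cSUP_upper)
  moreover have "closed {z. norm (G z) \<le> bidisc_norm G}"
    by (intro closed_Collect_le continuous_on_norm G continuous_on_const)
  ultimately have "closure bidisc \<subseteq> {z. norm (G z) \<le> bidisc_norm G}"
    by (rule closure_minimal)
  moreover have "closure bidisc = cball (0::complex) 1 \<times> cball (0::complex) 1"
    by (simp add: bidisc_eq closure_Times)
  ultimately show ?thesis
    using assms(2,3) by (auto simp: subset_iff)
qed

section \<open>The building blocks\<close>

text \<open>The coefficients form a Haar step: opposite constants on two adjacent blocks of
  \<open>N\<close> exponents.\<close>

definition haar :: "nat \<Rightarrow> complex poly" where
  "haar N = (\<Sum>j<2 * N. monom ((if j < N then 1 else - 1) / of_nat N ^ 2) j)"

lemma coeff_haar_eq_0: "2 * N \<le> j \<Longrightarrow> coeff (haar N) j = 0"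
  by (simp add: haar_def coeff_sum)

lemma sum_lessThan_double:
  fixes f :: "nat \<Rightarrow> 'a::comm_monoid_add"
  shows "(\<Sum>j<2 * N. f j) = (\<Sum>j<N. f j) + (\<Sum>j<N. f (N + j))"
  using sum.nat_group[of f N 2] sum.shift_bounds_nat_ivl[of f 0 N N]
  by (simp add: numeral_2_eq_2 lessThan_atLeast0 add.commute)

lemma poly_haar:
  "poly (haar N) x = (1 - x ^ N) * (\<Sum>j<N. x ^ j) / of_nat N ^ 2"
proof -
  have "poly (haar N) x = (\<Sum>j<N. x ^ j / of_nat N ^ 2) - (\<Sum>j<N. x ^ N * x ^ j / of_nat N ^ 2)"
    unfolding haar_def poly_sum poly_monom unfolding sum_lessThan_double
    by (simp add: power_add sum_negf)
  also have "\<dots> = (1 - x ^ N) * (\<Sum>j<N. x ^ j) / of_nat N ^ 2"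
    by (simp add: sum_distrib_left sum_divide_distrib left_diff_distrib diff_divide_distrib sum_subtractf)
  finally show ?thesis .
qed

text \<open>The right-hand side majorises min(t, 4/t) and is chosen to telescope: replacing
  \<open>N\<close> by \<open>2 * N\<close> replaces \<open>t\<close> by
  \<open>2 * t\<close>.\<close>

lemma norm_poly_haar_le:
  assumes "N > 0" "norm x \<le> 1" "x \<noteq> 1"
  defines "t \<equiv> real N * norm (1 - x)"
  shows "N * norm (poly (haar N) x) \<le> 15 * (1 / (1 + t) - 1 / (1 + 2 * t))"
proof -
  have t: "t > 0"
    using assms by (simp add: t_def)
  define s where "s = (\<Sum>j<N. x ^ j)"
  have s: "(1 - x) * s = 1 - x ^ N"
    unfolding s_def by (rule one_diff_power_eq[symmetric])
  have "norm s \<le> (\<Sum>j<N. norm (x ^ j))"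
    unfolding s_def by (rule norm_sum)
  also have "\<dots> \<le> (\<Sum>j<N. 1)"
    by (intro sum_mono) (simp add: norm_power power_le_one assms)
  finally have s_le: "norm s \<le> N" by simp
  have "norm (1 - x ^ N) \<le> 1 + norm (x ^ N)"
    using norm_triangle_ineq4[of 1 "x ^ N"] by simp
  also have "\<dots> \<le> 2"
    using assms by (simp add: norm_power power_le_one)
  finally have w_le: "norm (1 - x ^ N) \<le> 2" .
  have eq: "N * norm (poly (haar N) x) = norm (1 - x ^ N) * norm s / N"
    using \<open>N > 0\<close>
    by (simp add: poly_haar s_def[symmetric] norm_mult norm_divide norm_power power2_eq_square)
  have 1: "norm (1 - x ^ N) * norm s / N \<le> t"
  proof -
    have "norm (1 - x ^ N) * norm s = norm (1 - x) * (norm s * norm s)"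
      by (simp add: s[symmetric] norm_mult)
    also have "\<dots> \<le> norm (1 - x) * (real N * real N)"
      by (intro mult_left_mono mult_mono s_le) auto
    finally show ?thesis
      using \<open>N > 0\<close> by (simp add: t_def field_simps)
  qed
  have 2: "norm (1 - x ^ N) * norm s / N \<le> 4 / t"
  proof -
    have "norm (1 - x ^ N) * norm s * norm (1 - x) = norm (1 - x ^ N) * norm (1 - x ^ N)"
      by (simp add: s[symmetric] norm_mult mult_ac)
    also have "\<dots> \<le> 2 * 2"
      by (intro mult_mono w_le) auto
    finally show ?thesis
      using t \<open>N > 0\<close> \<open>x \<noteq> 1\<close> by (simp add: t_def field_simps)
  qed
  \<comment> \<open>The two bounds cross at t = 2, where (1 + t)(1 + 2t) = 15; this is the origin of
    the constant.\<close>
  have "min t (4 / t) \<le> 15 * (1 / (1 + t) - 1 / (1 + 2 * t))"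
  proof -
    have rhs: "15 * (1 / (1 + t) - 1 / (1 + 2 * t)) = 15 * t / ((1 + t) * (1 + 2 * t))"
      using t by (simp add: field_simps)
    show ?thesis
    proof (cases "t \<le> 2")
      case True
      have "(1 + t) * (1 + 2 * t) \<le> (1 + 2) * (1 + 2 * 2)"
        using True t by (intro mult_mono) auto
      then have "t * ((1 + t) * (1 + 2 * t)) \<le> t * 15"
        using t by (intro mult_left_mono) auto
      then have "t \<le> 15 * t / ((1 + t) * (1 + 2 * t))"
        using t by (simp add: pos_le_divide_eq mult.commute)
      then show ?thesis
        using rhs by linarith
    next
      case False
      have "2 * 2 \<le> t * t" "2 * t \<le> t * t"
        using False by (intro mult_mono; simp)+
      moreover have "4 * ((1 + t) * (1 + 2 * t)) = 4 + 12 * t + 8 * (t * t)"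
        by (simp add: algebra_simps)
      ultimately have "4 * ((1 + t) * (1 + 2 * t)) \<le> 15 * t * t"
        by simp
      then have "4 / t \<le> 15 * t / ((1 + t) * (1 + 2 * t))"
        using t by (simp add: divide_simps mult.commute)
      then show ?thesis
        using rhs by linarith
    qed
  qed
  with 1 2 show ?thesis
    unfolding eq by linarith
qed

lemma sum_norm_poly_haar_le:
  assumes "norm x \<le> 1"
  shows "(\<Sum>k<K. 2 ^ k * norm (poly (haar (2 ^ k)) x)) \<le> 15"
proof (cases "x = 1")
  case True
  then show ?thesis by (simp add: poly_haar)
next
  case False
  define f where "f k = 15 * (1 / (1 + 2 ^ k * norm (1 - x)))" for k
  have "(\<Sum>k<K. 2 ^ k * norm (poly (haar (2 ^ k)) x)) \<le> (\<Sum>k<K. f k - f (Suc k))"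
  proof (rule sum_mono)
    fix k
    \<comment> \<open>At level \<open>k\<close> the value of \<open>2 * t\<close> is the value of
      \<open>t\<close> at level \<open>Suc k\<close>.\<close>
    show "2 ^ k * norm (poly (haar (2 ^ k)) x) \<le> f k - f (Suc k)"
      using norm_poly_haar_le[of "2 ^ k" x] assms False
      by (simp add: f_def mult_ac)
  qed
  also have "\<dots> = f 0 - f K"
    by (rule sum_lessThan_telescope')
  also have "\<dots> \<le> 15"
  proof -
    have "f 0 \<le> 15" "f K \<ge> 0"
      by (auto simp: f_def divide_simps add_pos_nonneg)
    then show ?thesis by linarith
  qed
  finally show ?thesis .
qed

text \<open>The triangle inequality suffices: each of the \<open>2 * N\<close> terms has j < 2N,
  hence size at most (2N)^2 / N^2 = 4.\<close>

lemma norm_poly_theta_theta_haar_le: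
  assumes "norm x \<le> 1"
  shows "norm (poly (theta (theta (haar N))) x) \<le> 8 * N"
proof -
  have "norm (poly (theta (theta (haar N))) x)
      \<le> (\<Sum>j<2 * N. norm (of_nat j * (of_nat j * ((if j < N then 1 else - 1) / of_nat N ^ 2)) * x ^ j))"
    unfolding haar_def theta_sum_monom poly_sum poly_monom by (rule norm_sum)
  also have "\<dots> \<le> (\<Sum>j<2 * N. 4)"
  proof (rule sum_mono)
    fix j assume j: "j \<in> {..<2 * N}"
    have "norm (of_nat j * (of_nat j * ((if j < N then 1 else - 1) / of_nat N ^ 2)) * x ^ j)
        = (j * j) / N\<^sup>2 * norm x ^ j"
      by (simp add: norm_mult norm_divide norm_power)
    also have "\<dots> \<le> ((2 * N) * (2 * N)) / N\<^sup>2 * 1"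
      using j assms
      by (intro mult_mono divide_right_mono of_nat_mono power_le_one) auto
    also have "\<dots> = 4"
      using j by (auto simp: power2_eq_square)
    finally show "norm (of_nat j * (of_nat j * ((if j < N then 1 else - 1) / of_nat N ^ 2)) * x ^ j) \<le> 4"
      by simp
  qed
  finally show ?thesis by simp
qed

text \<open>Pairing the exponents j and N + j, each of the \<open>N\<close> pairs contributes -N /
  N^2.\<close>

lemma poly_theta_haar_1:
  assumes "N > 0"
  shows "poly (theta (haar N)) 1 = - 1"
proof -
  have "poly (theta (haar N)) 1 =
      (\<Sum>j<N. of_nat j / of_nat N ^ 2) + (\<Sum>j<N. - (of_nat (N + j) / of_nat N ^ 2))"
    unfolding haar_def theta_sum_monom poly_sum poly_monom unfolding sum_lessThan_double by simp
  also have "\<dots> = (\<Sum>j<N. - (of_nat N / of_nat N ^ 2))"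
    unfolding sum.distrib[symmetric] by (simp add: add_divide_distrib)
  also have "\<dots> = - 1"
    using assms by (simp add: power2_eq_square)
  finally show ?thesis .
qed

text \<open>The growth 8 * 2^k of the differentiated factor is absorbed by the weight 2^k in
  \<open>sum_norm_poly_haar_le\<close>, whence 120 = 8 * 15.\<close>

lemma norm_sum_haar_products_le:
  assumes "norm x \<le> 1" "norm y \<le> 1"
  shows "norm (\<Sum>k<K. poly (theta (theta (haar (2 ^ k)))) x * poly (haar (2 ^ k)) y) \<le> 120"
proof -
  have "norm (\<Sum>k<K. poly (theta (theta (haar (2 ^ k)))) x * poly (haar (2 ^ k)) y)
      \<le> (\<Sum>k<K. (8 * 2 ^ k) * norm (poly (haar (2 ^ k)) y))"
  proof (rule sum_norm_le)
    fix k
    show "norm (poly (theta (theta (haar (2 ^ k)))) x * poly (haar (2 ^ k)) y)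
        \<le> (8 * 2 ^ k) * norm (poly (haar (2 ^ k)) y)"
      unfolding norm_mult using norm_poly_theta_theta_haar_le[OF assms(1), of "2 ^ k"]
      by (intro mult_right_mono) auto
  qed
  also have "\<dots> = 8 * (\<Sum>k<K. 2 ^ k * norm (poly (haar (2 ^ k)) y))"
    by (simp add: sum_distrib_left mult.assoc)
  also have "\<dots> \<le> 8 * 15"
    by (intro mult_left_mono sum_norm_poly_haar_le assms) auto
  finally show ?thesis by simp
qed

section \<open>The extremal polynomials\<close>

lemma total_degree_eqI:
  assumes "coeff (coeff P b) a \<noteq> 0" "a + b = n"
    and "\<And>i j. coeff (coeff P j) i \<noteq> 0 \<Longrightarrow> i + j \<le> n"
  shows "total_degree P = n"
proof -
  have "finite {i + j | i j. coeff (coeff P j) i \<noteq> 0}"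
    by (rule finite_subset[of _ "{..n}"]) (use assms(3) in auto)
  then have "Max {i + j | i j. coeff (coeff P j) i \<noteq> 0} = n"
    by (rule Max_eqI) (use assms in auto)
  moreover have "P \<noteq> 0"
    using assms(1) by auto
  ultimately show ?thesis
    by (simp add: total_degree_def)
qed

text \<open>Index \<open>K\<close> carries the extra term z1^n / n^2, scaled so that its second
  Euler derivative in z1 is z1^n, of modulus at most 1 on the bidisc. Hence the normalisation 121 =
  120 + 1 in \<open>extremal\<close>.\<close>

definition factor1 :: "nat \<Rightarrow> nat \<Rightarrow> nat \<Rightarrow> complex poly" where
  "factor1 n K k = (if k < K then haar (2 ^ k) else monom (1 / of_nat n ^ 2) n)"

definition factor2 :: "nat \<Rightarrow> nat \<Rightarrow> complex poly" where
  "factor2 K k = (if k < K then haar (2 ^ k) else 1)"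

definition extremal :: "nat \<Rightarrow> nat \<Rightarrow> complex poly poly" where
  "extremal n K = (\<Sum>k\<le>K. tensor (smult (1 / 121) (factor1 n K k)) (factor2 K k))"

lemma theta_smult: "theta (smult c p) = smult c (theta p)"
  by (simp add: theta_def pderiv_smult)

lemma theta_monom: "theta (monom c n) = monom (of_nat n * c) n"
  using theta_sum_monom[of "\<lambda>_. c" "{n}"] by simp

lemma theta_const: "theta 0 = 0" "theta 1 = 0"
  by (simp_all add: theta_def)

lemma sum_atMost_split_last:
  "(\<Sum>k\<le>K. f k) = (\<Sum>k<K. f k) + f K" for f :: "nat \<Rightarrow> 'a::comm_monoid_add"
  by (simp flip: lessThan_Suc_atMost)

text \<open>In the Haar products both exponents are below 2^K, so the degree is at most 2^(K+1) - 2.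
  The hypothesis 2^K \<le> n keeps them from cancelling the monomial z1^n.\<close>

lemma total_degree_extremal:
  assumes "n \<ge> 1" "2 ^ Suc K \<le> n + 2" "2 ^ K \<le> n"
  shows "total_degree (extremal n K) = n"
proof (rule total_degree_eqI)
  have c: "coeff (coeff (extremal n K) j) i = 1 / 121 * ((\<Sum>k<K. coeff (haar (2 ^ k)) i * coeff (haar (2 ^ k)) j)
      + (if i = n \<and> j = 0 then 1 / of_nat n ^ 2 else 0))" for i j
    unfolding extremal_def coeff_sum coeff_tensor unfolding sum_atMost_split_last
    by (simp add: factor1_def factor2_def sum_distrib_left add_divide_distrib sum_divide_distrib mult_ac)
  have haar0: "coeff (haar (2 ^ k)) i = 0" if "k < K" "2 ^ K \<le> i" for i k
  proof -
    have "(2::nat) * 2 ^ k \<le> 2 ^ K"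
      using that power_increasing[of "Suc k" K "2::nat"] by simp
    with that show ?thesis
      by (intro coeff_haar_eq_0) simp
  qed
  show "coeff (coeff (extremal n K) 0) n \<noteq> 0"
    using assms haar0 by (simp add: c)
  show "n + 0 = n" by simp
  fix i j assume "coeff (coeff (extremal n K) j) i \<noteq> 0"
  then consider "i = n" "j = 0" | "(\<Sum>k<K. coeff (haar (2 ^ k)) i * coeff (haar (2 ^ k)) j) \<noteq> 0"
    by (auto simp: c split: if_splits)
  then show "i + j \<le> n"
  proof cases
    case 2
    then obtain k where k: "k < K" "coeff (haar (2 ^ k)) i \<noteq> 0" "coeff (haar (2 ^ k)) j \<noteq> 0"
      by (metis (no_types, lifting) lessThan_iff mult_eq_0_iff sum.neutral)
    then have "i < 2 ^ K" "j < 2 ^ K"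
      using haar0 by (meson not_le)+
    then show ?thesis
      using assms by simp
  qed simp
qed

text \<open>The extra term survives only in the first formula, since its z2-factor is
  constant.\<close>

lemma euler_extremal:
  assumes "n \<ge> 1"
  shows "euler1 (euler1 (poly2 (extremal n K))) (x, y) = 1 / 121 *
      ((\<Sum>k<K. poly (theta (theta (haar (2 ^ k)))) x * poly (haar (2 ^ k)) y) + x ^ n)"
    and "euler2 (euler2 (poly2 (extremal n K))) (x, y) = 1 / 121 *
      (\<Sum>k<K. poly (theta (theta (haar (2 ^ k)))) y * poly (haar (2 ^ k)) x)"
    and "euler2 (euler1 (poly2 (extremal n K))) (x, y) = 1 / 121 *
      (\<Sum>k<K. poly (theta (haar (2 ^ k))) x * poly (theta (haar (2 ^ k))) y)"
  using assms
  unfolding extremal_def poly2_sum_tensor euler1_sum_prod euler2_sum_prod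
  by (simp_all add: sum_prod_def sum_atMost_split_last factor1_def factor2_def theta_smult theta_monom
      theta_const poly_monom power2_eq_square sum_divide_distrib add_divide_distrib mult_ac)

theorem theorem3:
  "\<exists>c0::real. c0 > 0 \<and>
     (\<forall>n::nat. n \<ge> 1 \<longrightarrow>
       (\<exists>P :: complex poly poly. total_degree P = n \<and>
          bidisc_norm (euler1 (euler1 (poly2 P))) \<le> 1 \<and>
          bidisc_norm (euler2 (euler2 (poly2 P))) \<le> 1 \<and>
          bidisc_norm (euler2 (euler1 (poly2 P))) \<ge> c0 * ln (real n) powr (1 / 8)))"
proof (intro exI[of _ "1 / 484"] conjI allI impI)
  fix n :: nat assume n: "n \<ge> 1"
  \<comment> \<open>The largest power of two below the degree constraint 2^(K+1) \<le> n + 2 fixes K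
    = L - 1, so \<open>K\<close> has order log n.\<close>
  obtain L where L: "2 ^ L \<le> n + 2" "n + 2 < 2 ^ Suc L"
    using ex_power_ivl1[of 2 "n + 2"] by auto
  have "L \<noteq> 0"
    using L by (intro notI) simp
  then obtain K where K: "L = Suc K"
    by (cases L) auto
  have "2 ^ K \<le> n"
    using L n by (cases "n = 1"; cases K) (auto simp: K)
  \<comment> \<open>For n > 1, K is at least 1, so ln n \<le> K + 2 \<le> 4K; as 4K \<ge> 1, the
    exponent 1/8 may be raised to 1. For n = 1 the left side is 0. Dividing by 121 yields
    1/484.\<close>
  have bound: "ln (real n) powr (1 / 8) \<le> 4 * K"
  proof (cases "n = 1")
    case False
    then have "K \<noteq> 0"
      using L n by (intro notI) (simp add: K)
    have "real n \<le> 2 ^ (K + 2)"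
      using L(2) of_nat_mono[of n "2 ^ (K + 2)", where 'a=real] by (simp add: K)
    then have "ln (real n) \<le> ln (2 ^ (K + 2))"
      using n by (intro ln_mono) auto
    also have "\<dots> = (K + 2) * ln 2"
      by (rule ln_realpow)
    also have "\<dots> \<le> real (K + 2) * 1"
      using ln_2_less_1 by (intro mult_left_mono) auto
    finally have ln_le: "ln (real n) \<le> 4 * K"
      using \<open>K \<noteq> 0\<close> by simp
    have "ln (real n) powr (1 / 8) \<le> (4 * real K) powr (1 / 8)"
      using ln_le n by (intro powr_mono2) auto
    also have "\<dots> \<le> (4 * real K) powr 1"
      using \<open>K \<noteq> 0\<close> by (intro powr_mono) auto
    finally show ?thesis by simp
  qed simp
  show "\<exists>P. total_degree P = n \<and>
          bidisc_norm (euler1 (euler1 (poly2 P))) \<le> 1 \<and>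
          bidisc_norm (euler2 (euler2 (poly2 P))) \<le> 1 \<and>
          bidisc_norm (euler2 (euler1 (poly2 P))) \<ge> 1 / 484 * ln (real n) powr (1 / 8)"
  proof (intro exI[of _ "extremal n K"] conjI)
    show "total_degree (extremal n K) = n"
      using L n \<open>2 ^ K \<le> n\<close> by (intro total_degree_extremal) (auto simp: K)
    show "bidisc_norm (euler1 (euler1 (poly2 (extremal n K)))) \<le> 1"
    proof (rule bidisc_norm_le)
      fix x y :: complex assume xy: "norm x < 1" "norm y < 1"
      let ?S = "\<Sum>k<K. poly (theta (theta (haar (2 ^ k)))) x * poly (haar (2 ^ k)) y"
      have "norm (x ^ n) \<le> 1"
        using xy by (simp add: norm_power power_le_one)
      then have "norm (?S + x ^ n) \<le> 121"
        using norm_sum_haar_products_le[of x y K] xy norm_triangle_ineq[of ?S "x ^ n"] by simp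
      then show "norm (euler1 (euler1 (poly2 (extremal n K))) (x, y)) \<le> 1"
        using n by (simp add: euler_extremal norm_divide)
    qed
    show "bidisc_norm (euler2 (euler2 (poly2 (extremal n K)))) \<le> 1"
    proof (rule bidisc_norm_le)
      fix x y :: complex assume "norm x < 1" "norm y < 1"
      then show "norm (euler2 (euler2 (poly2 (extremal n K))) (x, y)) \<le> 1"
        using n norm_sum_haar_products_le[of y x K] by (simp add: euler_extremal norm_divide)
    qed
    have "continuous_on UNIV (euler2 (euler1 (poly2 (extremal n K))))"
      unfolding extremal_def poly2_sum_tensor euler1_sum_prod euler2_sum_prod
      by (rule continuous_on_sum_prod)
    then have "norm (euler2 (euler1 (poly2 (extremal n K))) (1, 1))
        \<le> bidisc_norm (euler2 (euler1 (poly2 (extremal n K))))"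
      by (rule norm_le_bidisc_norm) auto
    \<comment> \<open>Each of the \<open>K\<close> levels contributes (-1)(-1) = 1 at (1, 1), so
      nothing cancels.\<close>
    moreover have "norm (euler2 (euler1 (poly2 (extremal n K))) (1, 1)) = K / 121"
      using n by (simp add: euler_extremal poly_theta_haar_1 norm_divide)
    ultimately show "1 / 484 * ln (real n) powr (1 / 8) \<le>
        bidisc_norm (euler2 (euler1 (poly2 (extremal n K))))"
      using bound by simp
  qed
qed simp

end
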